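(* Let $f\colon\mathcal X\setminus\mathcal O\to(0,\infty)$ and $g\colon\mathcal O\to\mathbb R$. Let $$\mathcal S_{\mathcal M}=\bigl\{v\colon\mathcal X\to\mathbb R\ :\ v(x)\le F[v](x)\ \text{for } x\in\mathcal X\setminus\mathcal O,\ \ v(x)\le g(x)\ \text{for } x\in\mathcal O\bigr\}.$$ Assume $\mathcal S_{\mathcal M}$ is not empty, and that for each $x\in\mathcal X$ there exists $M(x)\in\mathbb R$ such that $v(x)\le M(x)$ for all $v\in\mathcal S_{\mathcal M}$. Then the function $u\colon\mathcal X\to\mathbb R$ defined by $$u(x)=\sup_{v\in\mathcal S_{\mathcal M}}v(x)$$ is the unique solution of $$\begin{cases}\displaystyle\inf_{\alpha\in\mathcal A_{n/2}}\sum_{i=1}^{n/2}\alpha_i\bigl(H_i[u](x)-u(x)\bigr)=\frac n2f(x)^{2/n},&x\in\mathcal X\setminus\mathcal O,\\ u(x)=g(x),&x\in\mathcal O.\end{cases}$$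
   Context: $\mathcal G=(\mathcal X,E)$ is a finite simple undirected graph, $\mathcal O\subseteq\mathcal X$ is the set of boundary vertices, and $\mathcal N_x$ is the set of neighbors of $x$. There is a fixed even integer $n\ge2$ with $|\mathcal N_x|=n$ for every $x\in\mathcal X\setminus\mathcal O$ (no degree condition on vertices of $\mathcal O$). For $u\colon\mathcal X\to\mathbb R$, $x\in\mathcal X\setminus\mathcal O$ and $i\in\{1,\dots,n/2\}$, define $$H_i[u](x)=\min_{\substack{S\subseteq\mathcal N_x\\ |S|=2i}}\ \max_{\substack{y,z\in S\\ y\ne z}}\frac{u(y)+u(z)}2.$$ Let $\mathcal A_k=\{\alpha\in(0,\infty)^k:\prod_{i=1}^k\alpha_i=1\}$ and, given $f$, for $x\in\mathcal X\setminus\mathcal O$, $$F[u](x)=\inf_{\alpha\in\mathcal A_{n/2}}\frac{\sum_{i=1}^{n/2}\alpha_iH_i[u](x)-\frac n2f(x)^{2/n}}{\sum_{i=1}^{n/2}\alpha_i}.$$ *)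

theory Defs
  imports
    Complex_Main
    "HOL-Library.FuncSet"
    "HOL-Library.Extended_Real"
    "Graph_Theory.Pair_Digraph"
begin

text \<open>
  Finite simple undirected graphs are those satisfying \<^locale>\<open>pair_graph\<close>: finite vertex set,
  symmetric and irreflexive arc relation. Real functions on a vertex set \<open>X\<close> are the
  elements of \<open>X \<rightarrow>\<^sub>E UNIV\<close>, so that equality of such functions is equality on \<open>X\<close>.
\<close>

definition neighbors :: "'a pair_pre_digraph \<Rightarrow> 'a \<Rightarrow> 'a set" where
  "neighbors G x = {y. (x, y) \<in> parcs G}"

definition H :: "'a pair_pre_digraph \<Rightarrow> nat \<Rightarrow> ('a \<Rightarrow> real) \<Rightarrow> 'a \<Rightarrow> real" where
  "H G i u x =
     (MIN S \<in> {S. S \<subseteq> neighbors G x \<and> card S = 2 * i}.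
        Max {(u y + u z) / 2 | y z. y \<in> S \<and> z \<in> S \<and> y \<noteq> z})"

definition \<A> :: "nat \<Rightarrow> (nat \<Rightarrow> real) set" where
  "\<A> k = {\<alpha> \<in> {1..k} \<rightarrow>\<^sub>E {0<..}. (\<Prod>i=1..k. \<alpha> i) = 1}"

text \<open>
  All infima over \<open>\<A> k\<close> are taken in the extended reals. This matters in \<open>solves\<close>
  below: when some \<open>H G i u x < u x\<close> the infimum can be \<open>-\<infinity>\<close>, whereas \<^const>\<open>Inf\<close> on
  \<^typ>\<open>real\<close> would be an unspecified number.
\<close>

definition F :: "'a pair_pre_digraph \<Rightarrow> nat \<Rightarrow> ('a \<Rightarrow> real) \<Rightarrow> ('a \<Rightarrow> real) \<Rightarrow> 'a \<Rightarrow> ereal" where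
  "F G n f u x =
     (INF \<alpha> \<in> \<A> (n div 2).
        ereal (((\<Sum>i=1..n div 2. \<alpha> i * H G i u x) - real n / 2 * f x powr (2 / real n))
               / (\<Sum>i=1..n div 2. \<alpha> i)))"

definition subsolutions ::
  "'a pair_pre_digraph \<Rightarrow> 'a set \<Rightarrow> nat \<Rightarrow> ('a \<Rightarrow> real) \<Rightarrow> ('a \<Rightarrow> real) \<Rightarrow> ('a \<Rightarrow> real) set" where
  "subsolutions G \<O> n f g =
     {v \<in> pverts G \<rightarrow>\<^sub>E UNIV.
        (\<forall>x \<in> pverts G - \<O>. ereal (v x) \<le> F G n f v x) \<and> (\<forall>x \<in> \<O>. v x \<le> g x)}"

definition solves ::
  "'a pair_pre_digraph \<Rightarrow> 'a set \<Rightarrow> nat \<Rightarrow> ('a \<Rightarrow> real) \<Rightarrow> ('a \<Rightarrow> real) \<Rightarrow> ('a \<Rightarrow> real) \<Rightarrow> bool" where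
  "solves G \<O> n f g u \<longleftrightarrow>
     (\<forall>x \<in> pverts G - \<O>.
        (INF \<alpha> \<in> \<A> (n div 2). ereal (\<Sum>i=1..n div 2. \<alpha> i * (H G i u x - u x)))
          = ereal (real n / 2 * f x powr (2 / real n))) \<and>
     (\<forall>x \<in> \<O>. u x = g x)"

end

theory Submission
  imports Defs
begin

text \<open>
  Write \<open>k = n / 2\<close> and \<open>c = k f(x)^(1/k)\<close>. Both \<open>v(x) \<le> F[v](x)\<close> and the equation speak about
  the weighted sums of \<open>a\<^sub>i = H\<^sub>i[v](x) - v(x)\<close>: the first says that \<open>c\<close> is a lower bound, the second
  that it is the infimum. As \<open>c > 0\<close>, a lower bound forces every \<open>a\<^sub>i > 0\<close>.
  Existence is Perron's method: since \<open>H\<^sub>i\<close> is monotone the supremum \<open>u\<close> is itself a subsolution, and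
  raising \<open>u\<close> at one vertex would contradict maximality. Hence for every \<open>e > 0\<close> some weight violates
  the lower bound for \<open>a - e\<close>, and positivity of the \<open>a\<^sub>i\<close> keeps such weights bounded as \<open>e\<close> tends to \<open>0\<close>.
  For uniqueness, compare a subsolution \<open>v\<close> with a solution \<open>w\<close> at a vertex \<open>x\<close> that
  maximises \<open>v - w\<close> and, among these, maximises \<open>v\<close>. There \<open>H\<^sub>i[v] - v \<le> H\<^sub>i[w] - w\<close> for all \<open>i\<close>, with equality
  because the infimum is strictly monotone on positive vectors. Equality for \<open>i = k\<close> makes the two
  neighbours carrying the largest values of \<open>v\<close> maximise \<open>v - w\<close> as well, and \<open>H\<^sub>k[v](x) > v(x)\<close> makes one of
  these values exceed \<open>v(x)\<close>.
\<close>

section \<open>Infima over weights of product one\<close>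

lemma \<A>_pos: "\<alpha> \<in> \<A> k \<Longrightarrow> i \<in> {1..k} \<Longrightarrow> 0 < \<alpha> i"
  by (auto simp: \<A>_def)

lemma sum_\<A>_pos: "\<alpha> \<in> \<A> k \<Longrightarrow> 1 \<le> k \<Longrightarrow> 0 < (\<Sum>i=1..k. \<alpha> i)"
  by (intro sum_pos) (auto dest: \<A>_pos)

text \<open>Turns the extended-real equation in \<open>solves\<close> into statements about real
  sums. The lower bound rules out the value -\<infinity>.\<close>

lemma INF_ereal_eq_iff:
  fixes h :: "'b \<Rightarrow> real"
  shows "(INF a\<in>A. ereal (h a)) = ereal c \<longleftrightarrow>
    (\<forall>a\<in>A. c \<le> h a) \<and> (\<forall>e>0. \<exists>a\<in>A. h a < c + e)"
proof
  assume eq: "(INF a\<in>A. ereal (h a)) = ereal c"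
  have "c \<le> h a" if "a \<in> A" for a
    using INF_lower[OF that, of "\<lambda>a. ereal (h a)"] eq by simp
  moreover have "\<exists>a\<in>A. h a < c + e" if "e > 0" for e
  proof -
    have "(INF a\<in>A. ereal (h a)) < ereal (c + e)" using eq that by simp
    then show ?thesis by (auto simp: INF_less_iff)
  qed
  ultimately show "(\<forall>a\<in>A. c \<le> h a) \<and> (\<forall>e>0. \<exists>a\<in>A. h a < c + e)" by blast
next
  assume r: "(\<forall>a\<in>A. c \<le> h a) \<and> (\<forall>e>0. \<exists>a\<in>A. h a < c + e)"
  show "(INF a\<in>A. ereal (h a)) = ereal c"
  proof (rule antisym)
    show "ereal c \<le> (INF a\<in>A. ereal (h a))" using r by (intro INF_greatest) auto
    show "(INF a\<in>A. ereal (h a)) \<le> ereal c"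
    proof (rule ereal_le_epsilon2)
      fix e :: real assume "0 < e"
      then obtain a where a: "a \<in> A" "h a < c + e" using r by blast
      have "(INF a\<in>A. ereal (h a)) \<le> ereal (h a)" by (rule INF_lower[OF a(1)])
      also have "\<dots> \<le> ereal c + ereal e" using a(2) by simp
      finally show "(INF a\<in>A. ereal (h a)) \<le> ereal c + ereal e" .
    qed
  qed
qed

text \<open>A nonpositive \<open>a j\<close> is detected by weights that are small away from \<open>j\<close>.\<close>

lemma weighted_sums_bounded_imp_pos:
  fixes a :: "nat \<Rightarrow> real"
  assumes c: "0 < c" and lb: "\<And>\<alpha>. \<alpha> \<in> \<A> k \<Longrightarrow> c \<le> (\<Sum>i=1..k. \<alpha> i * a i)"
    and j: "j \<in> {1..k}"
  shows "0 < a j"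
proof (rule ccontr)
  assume "\<not> 0 < a j"
  then have aj: "a j \<le> 0" by simp
  define B where "B = (\<Sum>i\<in>{1..k}-{j}. \<bar>a i\<bar>)"
  \<comment> \<open>The weight \<open>s\<close> away from \<open>j\<close> makes the other terms
    contribute at most \<open>s * B < c\<close>; the \<open>+ 1\<close> covers \<open>B = 0\<close>.
    The weight at \<open>j\<close> restores product one and multiplies a nonpositive number.\<close>
  define s where "s = c / (B + 1)"
  have B: "0 \<le> B" by (simp add: B_def sum_nonneg)
  have s: "0 < s" and sB: "s * B < c" using B c by (simp_all add: s_def field_simps)
  define \<alpha> where "\<alpha> = (\<lambda>i\<in>{1..k}. if i = j then 1 / s ^ (k - 1) else s)"
  have "(\<Prod>i=1..k. \<alpha> i) = \<alpha> j * (\<Prod>i\<in>{1..k}-{j}. \<alpha> i)"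
    using j by (simp add: prod.remove)
  also have "(\<Prod>i\<in>{1..k}-{j}. \<alpha> i) = (\<Prod>i\<in>{1..k}-{j}. s)"
    by (rule prod.cong) (auto simp: \<alpha>_def)
  also have "\<alpha> j * \<dots> = 1" using j s by (simp add: \<alpha>_def)
  finally have "\<alpha> \<in> \<A> k" using s by (auto simp: \<A>_def \<alpha>_def)
  then have "c \<le> (\<Sum>i=1..k. \<alpha> i * a i)" by (rule lb)
  also have "\<dots> = \<alpha> j * a j + (\<Sum>i\<in>{1..k}-{j}. \<alpha> i * a i)"
    using j by (simp add: sum.remove)
  also have "\<alpha> j * a j \<le> 0"
    using j s aj by (simp add: \<alpha>_def divide_nonpos_pos)
  also have "(\<Sum>i\<in>{1..k}-{j}. \<alpha> i * a i) \<le> (\<Sum>i\<in>{1..k}-{j}. s * \<bar>a i\<bar>)"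
    using s by (intro sum_mono) (auto simp: \<alpha>_def)
  also have "\<dots> = s * B" by (simp add: B_def sum_distrib_left)
  finally show False using sB by simp
qed

text \<open>Enlarging \<open>a j\<close> by a factor \<open>r ^ k\<close> enlarges the infimum by the factor \<open>r\<close>, because the weights
  can absorb the change.\<close>

lemma weighted_sums_bounded_strict_mono:
  fixes a b :: "nat \<Rightarrow> real"
  assumes c: "0 < c" and lb: "\<And>\<alpha>. \<alpha> \<in> \<A> k \<Longrightarrow> c \<le> (\<Sum>i=1..k. \<alpha> i * a i)"
    and le: "\<And>i. i \<in> {1..k} \<Longrightarrow> a i \<le> b i"
    and j: "j \<in> {1..k}" and less: "a j < b j"
  obtains c' where "c < c'" "\<And>\<alpha>. \<alpha> \<in> \<A> k \<Longrightarrow> c' \<le> (\<Sum>i=1..k. \<alpha> i * b i)"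
proof -
  have aj: "0 < a j" by (rule weighted_sums_bounded_imp_pos[OF c lb j])
  define l where "l = b j / a j"
  have l: "1 < l" using aj less by (simp add: l_def)
  define r where "r = root k l"
  have k: "0 < k" using j by simp
  have r: "1 < r" using l k by (simp add: r_def)
  have rk: "r ^ k = l" using l k by (simp add: r_def)
  show thesis
  proof (rule that)
    show "c < r * c" using r c by simp
    fix \<alpha> assume \<alpha>: "\<alpha> \<in> \<A> k"
    \<comment> \<open>The product is \<open>l / r ^ k = 1\<close>. By choice of \<open>l\<close>,
      \<open>r * (\<beta> j * a j) = \<alpha> j * b j\<close>; at other indices the factor
      \<open>r\<close> cancels and \<open>a i \<le> b i\<close> suffices.\<close>
    define \<beta> where "\<beta> = (\<lambda>i\<in>{1..k}. (if i = j then l else 1) * (\<alpha> i / r))"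
    have "(\<Prod>i=1..k. \<beta> i) = (\<Prod>i=1..k. (if i = j then l else 1) * (\<alpha> i / r))"
      by (rule prod.cong) (auto simp: \<beta>_def)
    also have "\<dots> = l * ((\<Prod>i=1..k. \<alpha> i) / r ^ k)"
      using j by (simp only: prod.distrib) (simp add: prod.delta prod_dividef)
    also have "\<dots> = 1" using \<alpha> l rk by (simp add: \<A>_def)
    finally have "\<beta> \<in> \<A> k"
      using \<alpha> l r by (auto simp: \<A>_def \<beta>_def PiE_iff)
    then have "c \<le> (\<Sum>i=1..k. \<beta> i * a i)" by (rule lb)
    then have "r * c \<le> r * (\<Sum>i=1..k. \<beta> i * a i)" using r by simp
    also have "\<dots> = (\<Sum>i=1..k. r * (\<beta> i * a i))" by (rule sum_distrib_left)
    also have "\<dots> \<le> (\<Sum>i=1..k. \<alpha> i * b i)"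
    proof (rule sum_mono)
      fix i assume i: "i \<in> {1..k}"
      show "r * (\<beta> i * a i) \<le> \<alpha> i * b i"
      proof (cases "i = j")
        case True
        then show ?thesis using i r aj by (simp add: \<beta>_def l_def)
      next
        case False
        then show ?thesis using i r le[OF i] \<A>_pos[OF \<alpha> i] by (simp add: \<beta>_def)
      qed
    qed
    finally show "r * c \<le> (\<Sum>i=1..k. \<alpha> i * b i)" .
  qed
qed

text \<open>The violating weight may change with the shift, so a bound on its total is needed; the
  least \<open>a i\<close>, being positive, provides one.\<close>

lemma weighted_sums_approach_bound:
  fixes a :: "nat \<Rightarrow> real"
  assumes c: "0 < c" and lb: "\<And>\<alpha>. \<alpha> \<in> \<A> k \<Longrightarrow> c \<le> (\<Sum>i=1..k. \<alpha> i * a i)"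
    and k: "1 \<le> k"
    and tight: "\<And>e. 0 < e \<Longrightarrow> \<exists>\<alpha>\<in>\<A> k. (\<Sum>i=1..k. \<alpha> i * (a i - e)) < c"
    and e: "0 < e"
  shows "\<exists>\<alpha>\<in>\<A> k. (\<Sum>i=1..k. \<alpha> i * a i) < c + e"
proof -
  define m where "m = Min (a ` {1..k})"
  have "m \<in> a ` {1..k}" unfolding m_def using k by (intro Min_in) auto
  then have m: "0 < m" using weighted_sums_bounded_imp_pos[OF c lb] by auto
  \<comment> \<open>The first entry turns \<open>t * m < c + t * d\<close> into
    \<open>t * m < 2 * c\<close>; with this, the second gives \<open>t * d < e\<close>.\<close>
  define d where "d = min (m / 2) (e * m / (2 * c))"
  have d: "0 < d" using m e c by (simp add: d_def)
  obtain \<alpha> where \<alpha>: "\<alpha> \<in> \<A> k" and lt: "(\<Sum>i=1..k. \<alpha> i * (a i - d)) < c"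
    using tight[OF d] by blast
  define t where "t = (\<Sum>i=1..k. \<alpha> i)"
  have t: "0 < t" using sum_\<A>_pos[OF \<alpha> k] by (simp add: t_def)
  have eq: "(\<Sum>i=1..k. \<alpha> i * (a i - d)) = (\<Sum>i=1..k. \<alpha> i * a i) - t * d"
    by (simp add: t_def algebra_simps sum_subtractf sum_distrib_left)
  have "t * m = (\<Sum>i=1..k. \<alpha> i * m)" by (simp add: t_def sum_distrib_right)
  also have "\<dots> \<le> (\<Sum>i=1..k. \<alpha> i * a i)"
  proof (rule sum_mono)
    fix i assume i: "i \<in> {1..k}"
    then have "m \<le> a i" unfolding m_def by (intro Min_le) auto
    then show "\<alpha> i * m \<le> \<alpha> i * a i" using \<A>_pos[OF \<alpha> i] by simp
  qed
  also have "\<dots> < c + t * d" using lt eq by simp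
  also have "t * d \<le> t * (m / 2)" using t by (intro mult_left_mono) (auto simp: d_def)
  finally have tm: "t * m < 2 * c" by simp
  have "t * d \<le> t * (e * m / (2 * c))" using t by (intro mult_left_mono) (auto simp: d_def)
  also have "\<dots> = (t * m) * (e / (2 * c))" by simp
  also have "\<dots> < (2 * c) * (e / (2 * c))" using tm e c by (intro mult_strict_right_mono) auto
  also have "\<dots> = e" using c by simp
  finally show ?thesis using lt eq \<alpha> by (intro bexI[of _ \<alpha>]) auto
qed

section \<open>The operators \<open>H\<^sub>i\<close>\<close>

text \<open>For finite \<open>S\<close> with at least two elements, this is the mean of the two
  largest values of \<open>u\<close> on \<open>S\<close>, counted with multiplicity.\<close>

definition pair_max :: "('a \<Rightarrow> real) \<Rightarrow> 'a set \<Rightarrow> real" where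
  "pair_max u S = Max {(u y + u z) / 2 | y z. y \<in> S \<and> z \<in> S \<and> y \<noteq> z}"

lemma H_eq_MIN_pair_max:
  "H G i u x = (MIN S \<in> {S. S \<subseteq> neighbors G x \<and> card S = 2 * i}. pair_max u S)"
  by (simp add: H_def pair_max_def)

lemma finite_pair_means:
  fixes u :: "'a \<Rightarrow> real"
  assumes "finite S"
  shows "finite {(u y + u z) / 2 | y z. y \<in> S \<and> z \<in> S \<and> y \<noteq> z}"
proof (rule finite_subset)
  show "{(u y + u z) / 2 | y z. y \<in> S \<and> z \<in> S \<and> y \<noteq> z} \<subseteq> (\<lambda>(y, z). (u y + u z) / 2) ` (S \<times> S)"
    by force
qed (use assms in simp)

lemma pair_max_ge:
  assumes "finite S" "y \<in> S" "z \<in> S" "y \<noteq> z"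
  shows "(u y + u z) / 2 \<le> pair_max u S"
  unfolding pair_max_def using assms by (intro Max_ge finite_pair_means) auto

lemma pair_max_attained:
  assumes "2 \<le> card S"
  obtains y z where "y \<in> S" "z \<in> S" "y \<noteq> z" "pair_max u S = (u y + u z) / 2"
proof -
  have fin: "finite S" using assms by (metis card.infinite not_numeral_le_zero)
  obtain T where "T \<subseteq> S" "card T = 2"
    using obtain_subset_with_card_n[OF assms] by blast
  then obtain y z where "y \<in> S" "z \<in> S" "y \<noteq> z"
    by (auto simp: card_2_iff)
  then have "{(u y + u z) / 2 | y z. y \<in> S \<and> z \<in> S \<and> y \<noteq> z} \<noteq> {}" by blast
  then have "pair_max u S \<in> {(u y + u z) / 2 | y z. y \<in> S \<and> z \<in> S \<and> y \<noteq> z}"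
    unfolding pair_max_def by (intro Max_in finite_pair_means[OF fin])
  then show thesis using that by blast
qed

lemma pair_max_shift_mono:
  assumes "2 \<le> card S" and le: "\<And>y. y \<in> S \<Longrightarrow> u y \<le> v y + M"
  shows "pair_max u S \<le> pair_max v S + M"
proof -
  have fin: "finite S" using assms(1) by (metis card.infinite not_numeral_le_zero)
  obtain y z where yz: "y \<in> S" "z \<in> S" "y \<noteq> z" "pair_max u S = (u y + u z) / 2"
    by (rule pair_max_attained[OF assms(1)])
  show ?thesis using pair_max_ge[OF fin yz(1-3), of v] le[OF yz(1)] le[OF yz(2)] yz(4)
    by (simp add: field_simps)
qed

text \<open>A set \<open>S\<close> that is optimal for \<open>v\<close> competes in the minimum for
  \<open>u\<close>. \<open>M = 0\<close> gives monotonicity; the comparison argument takes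
  \<open>M\<close> to be the maximum of \<open>v - w\<close>.\<close>

lemma H_shift_mono:
  assumes fin: "finite (neighbors G x)" and i: "1 \<le> i" "2 * i \<le> card (neighbors G x)"
    and le: "\<And>y. y \<in> neighbors G x \<Longrightarrow> u y \<le> v y + M"
  shows "H G i u x \<le> H G i v x + M"
proof -
  let ?P = "{S. S \<subseteq> neighbors G x \<and> card S = 2 * i}"
  have finP: "finite ?P" using fin by simp
  have "?P \<noteq> {}" using obtain_subset_with_card_n[OF i(2)] by blast
  then have "H G i v x \<in> pair_max v ` ?P"
    unfolding H_eq_MIN_pair_max using finP by (intro Min_in) auto
  then obtain S where S: "S \<subseteq> neighbors G x" "card S = 2 * i" "H G i v x = pair_max v S"
    by auto
  have "H G i u x \<le> pair_max u S"
    unfolding H_eq_MIN_pair_max using finP S by (intro Min_le) auto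
  also have "\<dots> \<le> pair_max v S + M" using S i le by (intro pair_max_shift_mono) auto
  finally show ?thesis using S by simp
qed

lemma H_top:
  assumes "finite (neighbors G x)" "card (neighbors G x) = 2 * i"
  shows "H G i u x = pair_max u (neighbors G x)"
proof -
  have "{S. S \<subseteq> neighbors G x \<and> card S = 2 * i} = {neighbors G x}"
    using assms by (auto dest: card_subset_eq)
  then show ?thesis by (simp add: H_eq_MIN_pair_max)
qed

section \<open>Subsolutions and solutions\<close>

locale dirichlet_problem = pair_graph G for G :: "'a pair_pre_digraph" (structure) +
  fixes \<O> :: "'a set" and n :: nat and f g :: "'a \<Rightarrow> real"
  assumes boundary: "\<O> \<subseteq> pverts G"
    and even_n: "even n" and n_ge_2: "n \<ge> 2"
    and degree: "\<And>x. x \<in> pverts G - \<O> \<Longrightarrow> card (neighbors G x) = n"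
    and f_pos: "\<And>x. x \<in> pverts G - \<O> \<Longrightarrow> f x > 0"
begin

definition rhs :: "'a \<Rightarrow> real" where
  "rhs x = real n / 2 * f x powr (2 / real n)"

text \<open>The value \<open>t\<close> at \<open>x\<close> is kept apart from \<open>v\<close>, so
  that it can be raised, or \<open>v\<close> replaced by a larger function, independently.\<close>

definition lower_bound :: "('a \<Rightarrow> real) \<Rightarrow> 'a \<Rightarrow> real \<Rightarrow> bool" where
  "lower_bound v x t \<longleftrightarrow>
    (\<forall>\<alpha>\<in>\<A> (n div 2). rhs x \<le> (\<Sum>i=1..n div 2. \<alpha> i * (H G i v x - t)))"

lemma half_n: "1 \<le> n div 2" "2 * (n div 2) = n"
  using even_n n_ge_2 by auto

lemma rhs_pos: "x \<in> pverts G - \<O> \<Longrightarrow> 0 < rhs x"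
  using f_pos[of x] n_ge_2 by (simp add: rhs_def)

lemma neighbors_subset: "neighbors G x \<subseteq> pverts G"
  using in_arcsD2 by (auto simp: neighbors_def)

lemma finite_neighbors: "finite (neighbors G x)"
  using neighbors_subset pair_finite_verts by (rule finite_subset)

lemma le_F_iff: "ereal t \<le> F G n f v x \<longleftrightarrow> lower_bound v x t"
proof -
  have "t \<le> ((\<Sum>i=1..n div 2. \<alpha> i * H G i v x) - rhs x) / (\<Sum>i=1..n div 2. \<alpha> i) \<longleftrightarrow>
      rhs x \<le> (\<Sum>i=1..n div 2. \<alpha> i * (H G i v x - t))" if "\<alpha> \<in> \<A> (n div 2)" for \<alpha>
    using sum_\<A>_pos[OF that half_n(1)]
    by (simp add: pos_le_divide_eq right_diff_distrib sum_subtractf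
        flip: sum_distrib_right) (simp add: algebra_simps)
  then show ?thesis by (auto simp: F_def lower_bound_def le_INF_iff rhs_def)
qed

lemma subsolutions_iff:
  "v \<in> subsolutions G \<O> n f g \<longleftrightarrow> v \<in> pverts G \<rightarrow>\<^sub>E UNIV \<and>
    (\<forall>x\<in>pverts G - \<O>. lower_bound v x (v x)) \<and> (\<forall>x\<in>\<O>. v x \<le> g x)"
  by (simp add: subsolutions_def le_F_iff)

lemma solves_iff:
  "solves G \<O> n f g w \<longleftrightarrow>
    (\<forall>x\<in>pverts G - \<O>. lower_bound w x (w x) \<and>
      (\<forall>e>0. \<exists>\<alpha>\<in>\<A> (n div 2). (\<Sum>i=1..n div 2. \<alpha> i * (H G i w x - w x)) < rhs x + e)) \<and>
    (\<forall>x\<in>\<O>. w x = g x)"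
  unfolding solves_def INF_ereal_eq_iff lower_bound_def rhs_def ..

lemma H_mono_at:
  assumes x: "x \<in> pverts G - \<O>" and i: "i \<in> {1..n div 2}"
    and le: "\<And>y. y \<in> neighbors G x \<Longrightarrow> u y \<le> v y + M"
  shows "H G i u x \<le> H G i v x + M"
  using i degree[OF x] half_n by (intro H_shift_mono finite_neighbors le) auto

lemma lower_bound_mono:
  assumes x: "x \<in> pverts G - \<O>" and lb: "lower_bound v x t"
    and le: "\<And>y. y \<in> neighbors G x \<Longrightarrow> v y \<le> u y"
  shows "lower_bound u x t"
  unfolding lower_bound_def
proof
  fix \<alpha> assume \<alpha>: "\<alpha> \<in> \<A> (n div 2)"
  have "rhs x \<le> (\<Sum>i=1..n div 2. \<alpha> i * (H G i v x - t))"
    using lb \<alpha> by (auto simp: lower_bound_def)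
  also have "\<dots> \<le> (\<Sum>i=1..n div 2. \<alpha> i * (H G i u x - t))"
  proof (rule sum_mono)
    fix i assume i: "i \<in> {1..n div 2}"
    have "H G i v x \<le> H G i u x" using H_mono_at[OF x i, of v u 0] le by simp
    then show "\<alpha> i * (H G i v x - t) \<le> \<alpha> i * (H G i u x - t)"
      using \<A>_pos[OF \<alpha> i] by simp
  qed
  finally show "rhs x \<le> (\<Sum>i=1..n div 2. \<alpha> i * (H G i u x - t))" .
qed

lemma lower_bound_imp_less_H:
  assumes "x \<in> pverts G - \<O>" "lower_bound v x t" "i \<in> {1..n div 2}"
  shows "t < H G i v x"
  using weighted_sums_bounded_imp_pos[OF rhs_pos[OF assms(1)] _ assms(3), of "\<lambda>i. H G i v x - t"]
    assms(2) by (auto simp: lower_bound_def)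

section \<open>Comparison of subsolutions with solutions\<close>

lemma comparison:
  assumes v: "v \<in> subsolutions G \<O> n f g" and w: "solves G \<O> n f g w" and x: "x \<in> pverts G"
  shows "v x \<le> w x"
proof (rule ccontr)
  let ?k = "n div 2"
  assume neg: "\<not> v x \<le> w x"
  define M where "M = Max ((\<lambda>y. v y - w y) ` pverts G)"
  have M_ge: "v y - w y \<le> M" if "y \<in> pverts G" for y
    unfolding M_def using that pair_finite_verts by (intro Max_ge) auto
  have M_pos: "0 < M" using neg M_ge[OF x] by simp
  define D where "D = {y \<in> pverts G. v y - w y = M}"
  have finD: "finite D" using pair_finite_verts by (simp add: D_def)
  have "M \<in> (\<lambda>y. v y - w y) ` pverts G"
    unfolding M_def using x pair_finite_verts by (intro Max_in) auto
  then have "D \<noteq> {}" by (auto simp: D_def)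
  then have "Max (v ` D) \<in> v ` D" using finD by (intro Max_in) auto
  then obtain p where p: "p \<in> D" and p_max: "v p = Max (v ` D)" by auto
  have v_le: "v y \<le> v p" if "y \<in> D" for y
    unfolding p_max using finD that by (intro Max_ge) auto
  have pV: "p \<in> pverts G" and pM: "v p - w p = M" using p by (auto simp: D_def)
  have "p \<notin> \<O>"
  proof
    assume "p \<in> \<O>"
    then have "v p \<le> w p" using v w by (simp add: subsolutions_iff solves_iff)
    then show False using pM M_pos by simp
  qed
  with pV have pI: "p \<in> pverts G - \<O>" by simp
  have lb: "lower_bound v p (v p)" using v pI by (simp add: subsolutions_iff)
  have le_nb: "v y \<le> w y + M" if "y \<in> neighbors G p" for y
    using M_ge[of y] neighbors_subset that by force
  have H_le: "H G i v p - v p \<le> H G i w p - w p" if "i \<in> {1..?k}" for i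
    using H_mono_at[OF pI that, of v w M] le_nb pM by simp
  have k: "?k \<in> {1..?k}" using half_n(1) by simp
  \<comment> \<open>A strict gap would lift the lower bound for \<open>w\<close> above
    \<open>rhs p\<close>, which is the infimum for \<open>w\<close>.\<close>
  have "\<not> H G ?k v p - v p < H G ?k w p - w p"
  proof
    assume less: "H G ?k v p - v p < H G ?k w p - w p"
    have lb': "rhs p \<le> (\<Sum>i=1..?k. \<alpha> i * (H G i v p - v p))" if "\<alpha> \<in> \<A> ?k" for \<alpha>
      using lb that by (simp add: lower_bound_def)
    obtain c' where c': "rhs p < c'"
      "\<And>\<alpha>. \<alpha> \<in> \<A> ?k \<Longrightarrow> c' \<le> (\<Sum>i=1..?k. \<alpha> i * (H G i w p - w p))"
      using weighted_sums_bounded_strict_mono[where a = "\<lambda>i. H G i v p - v p"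
          and b = "\<lambda>i. H G i w p - w p", OF rhs_pos[OF pI] lb' H_le k less] by blast
    have "0 < c' - rhs p" using c'(1) by simp
    then obtain \<alpha> where \<alpha>: "\<alpha> \<in> \<A> ?k"
      "(\<Sum>i=1..?k. \<alpha> i * (H G i w p - w p)) < rhs p + (c' - rhs p)"
      using w pI unfolding solves_iff by blast
    show False using c'(2)[OF \<alpha>(1)] \<alpha>(2) by simp
  qed
  then have H_eq: "H G ?k v p = H G ?k w p + M" using H_le[OF k] pM by simp
  have card_nb: "card (neighbors G p) = 2 * ?k" using degree[OF pI] half_n by simp
  note top = H_top[OF finite_neighbors card_nb]
  have "2 \<le> card (neighbors G p)" using card_nb half_n(1) by simp
  then obtain y z where yz: "y \<in> neighbors G p" "z \<in> neighbors G p" "y \<noteq> z"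
    and vyz: "pair_max v (neighbors G p) = (v y + v z) / 2"
    by (rule pair_max_attained)
  \<comment> \<open>The pair optimal for \<open>v\<close> also competes for \<open>w\<close>. Since
    \<open>v \<le> w + M\<close> at \<open>y\<close> and at \<open>z\<close>, equality of the means
    forces equality at both.\<close>
  have "(w y + w z) / 2 + M \<le> (v y + v z) / 2"
    using pair_max_ge[OF finite_neighbors yz, of w] H_eq vyz top by simp
  then have "v y - w y = M" "v z - w z = M" using le_nb[OF yz(1)] le_nb[OF yz(2)]
    by (simp_all add: field_simps)
  then have "y \<in> D" "z \<in> D" using yz neighbors_subset by (auto simp: D_def)
  then have "(v y + v z) / 2 \<le> v p" using v_le[of y] v_le[of z] by simp
  moreover have "v p < (v y + v z) / 2"
    using lower_bound_imp_less_H[OF pI lb k] vyz top by simp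
  ultimately show False by simp
qed

section \<open>Perron's method\<close>

text \<open>Raising one value lowers no \<open>H G i\<close>, so the lower bounds at other vertices
  survive; only the new value \<open>t\<close> at \<open>x\<close> has to be checked.\<close>

lemma raise_subsolution:
  assumes u: "u \<in> subsolutions G \<O> n f g" and x: "x \<in> pverts G" and le: "u x \<le> t"
    and inner: "x \<notin> \<O> \<Longrightarrow> lower_bound u x t" and bd: "x \<in> \<O> \<Longrightarrow> t \<le> g x"
  shows "u(x := t) \<in> subsolutions G \<O> n f g"
  unfolding subsolutions_iff
proof (intro conjI ballI)
  show "u(x := t) \<in> pverts G \<rightarrow>\<^sub>E UNIV"
    using u x by (auto simp: subsolutions_iff PiE_iff extensional_def)
  fix y assume y: "y \<in> pverts G - \<O>"
  have "lower_bound u y ((u(x := t)) y)"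
    using u y inner by (auto simp: subsolutions_iff)
  then show "lower_bound (u(x := t)) y ((u(x := t)) y)"
    by (rule lower_bound_mono[OF y]) (use le in auto)
next
  fix y assume "y \<in> \<O>"
  then show "(u(x := t)) y \<le> g y" using u bd by (auto simp: subsolutions_iff)
qed

lemma greatest_subsolution_solves:
  assumes u: "u \<in> subsolutions G \<O> n f g"
    and greatest: "\<And>v x. v \<in> subsolutions G \<O> n f g \<Longrightarrow> x \<in> pverts G \<Longrightarrow> v x \<le> u x"
  shows "solves G \<O> n f g u"
  unfolding solves_iff
proof (intro conjI ballI allI impI)
  fix x assume x: "x \<in> \<O>"
  then have xV: "x \<in> pverts G" using boundary by blast
  have le: "u x \<le> g x" using u x by (simp add: subsolutions_iff)
  \<comment> \<open>A boundary vertex carries only the constraint \<open>v x \<le> g x\<close>, so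
    its value can be raised to \<open>g x\<close> at once.\<close>
  have "u(x := g x) \<in> subsolutions G \<O> n f g"
    using x by (intro raise_subsolution u xV le) auto
  then show "u x = g x" using greatest[OF _ xV] le by fastforce
next
  fix x assume x: "x \<in> pverts G - \<O>"
  show lb: "lower_bound u x (u x)" using u x by (simp add: subsolutions_iff)
  fix e :: real assume e: "0 < e"
  show "\<exists>\<alpha>\<in>\<A> (n div 2). (\<Sum>i=1..n div 2. \<alpha> i * (H G i u x - u x)) < rhs x + e"
  proof (rule weighted_sums_approach_bound[OF rhs_pos[OF x] _ half_n(1) _ e])
    fix \<alpha> assume "\<alpha> \<in> \<A> (n div 2)"
    then show "rhs x \<le> (\<Sum>i=1..n div 2. \<alpha> i * (H G i u x - u x))"
      using lb by (simp add: lower_bound_def)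
  next
    fix d :: real assume d: "0 < d"
    have "\<not> lower_bound u x (u x + d)"
    proof
      assume "lower_bound u x (u x + d)"
      then have "u(x := u x + d) \<in> subsolutions G \<O> n f g"
        using x d by (intro raise_subsolution u) auto
      then show False using greatest[of "u(x := u x + d)" x] x d by simp
    qed
    then show "\<exists>\<alpha>\<in>\<A> (n div 2). (\<Sum>i=1..n div 2. \<alpha> i * (H G i u x - u x - d)) < rhs x"
      by (auto simp: lower_bound_def not_le diff_diff_eq)
  qed
qed

text \<open>For a fixed weight the inequality, solved for \<open>v x\<close>, is an upper bound.
  Replacing \<open>v\<close> by \<open>u\<close> inside \<open>H G i\<close> makes this bound
  independent of \<open>v\<close>, so it passes to the supremum.\<close>

lemma Sup_subsolution:
  assumes le: "\<And>v x. v \<in> subsolutions G \<O> n f g \<Longrightarrow> x \<in> pverts G \<Longrightarrow> v x \<le> u x"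
    and least: "\<And>x t. x \<in> pverts G \<Longrightarrow> (\<And>v. v \<in> subsolutions G \<O> n f g \<Longrightarrow> v x \<le> t) \<Longrightarrow> u x \<le> t"
    and ext: "u \<in> pverts G \<rightarrow>\<^sub>E UNIV"
  shows "u \<in> subsolutions G \<O> n f g"
  unfolding subsolutions_iff
proof (intro conjI ballI ext)
  fix x assume x: "x \<in> \<O>"
  then show "u x \<le> g x" using boundary by (intro least) (auto simp: subsolutions_iff)
next
  fix x assume x: "x \<in> pverts G - \<O>"
  show "lower_bound u x (u x)"
    unfolding lower_bound_def
  proof
    fix \<alpha> assume \<alpha>: "\<alpha> \<in> \<A> (n div 2)"
    define s where "s = (\<Sum>i=1..n div 2. \<alpha> i)"
    have s: "0 < s" unfolding s_def by (rule sum_\<A>_pos[OF \<alpha> half_n(1)])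
    have split: "(\<Sum>i=1..n div 2. \<alpha> i * (H G i u x - t)) =
        (\<Sum>i=1..n div 2. \<alpha> i * H G i u x) - s * t" for t
      by (simp add: s_def right_diff_distrib sum_subtractf sum_distrib_right)
    have "u x \<le> ((\<Sum>i=1..n div 2. \<alpha> i * H G i u x) - rhs x) / s"
    proof (rule least)
      fix v assume v: "v \<in> subsolutions G \<O> n f g"
      then have "lower_bound v x (v x)" using x by (simp add: subsolutions_iff)
      then have "lower_bound u x (v x)"
        by (rule lower_bound_mono[OF x]) (use le[OF v] neighbors_subset in auto)
      then have "rhs x \<le> (\<Sum>i=1..n div 2. \<alpha> i * (H G i u x - v x))"
        using \<alpha> by (simp add: lower_bound_def)
      then have "rhs x \<le> (\<Sum>i=1..n div 2. \<alpha> i * H G i u x) - s * v x"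
        by (simp only: split)
      then show "v x \<le> ((\<Sum>i=1..n div 2. \<alpha> i * H G i u x) - rhs x) / s"
        using s by (simp add: field_simps)
    qed (use x in simp)
    then show "rhs x \<le> (\<Sum>i=1..n div 2. \<alpha> i * (H G i u x - u x))"
      using s unfolding split by (simp add: field_simps)
  qed
qed

end

theorem theorem3p7:
  fixes G :: "'a pair_pre_digraph" and \<O> :: "'a set" and n :: nat
    and f g u :: "'a \<Rightarrow> real"
  assumes "pair_graph G"
    and "\<O> \<subseteq> pverts G"
    and "even n" and "n \<ge> 2"
    and "\<And>x. x \<in> pverts G - \<O> \<Longrightarrow> card (neighbors G x) = n"
    and "\<And>x. x \<in> pverts G - \<O> \<Longrightarrow> f x > 0"
    and "subsolutions G \<O> n f g \<noteq> {}"
    and "\<And>x. x \<in> pverts G \<Longrightarrow> \<exists>M. \<forall>v \<in> subsolutions G \<O> n f g. v x \<le> M"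
    and "u = (\<lambda>x \<in> pverts G. SUP v \<in> subsolutions G \<O> n f g. v x)"
  shows "solves G \<O> n f g u \<and>
    (\<forall>w \<in> pverts G \<rightarrow>\<^sub>E UNIV. solves G \<O> n f g w \<longrightarrow> w = u)"
proof -
  interpret pair_graph G by fact
  interpret dirichlet_problem G \<O> n f g
    by unfold_locales (use assms in auto)
  let ?S = "subsolutions G \<O> n f g"
  \<comment> \<open>A real \<open>SUP\<close> is a genuine supremum only over a nonempty set that is
    bounded above.\<close>
  have bdd: "bdd_above ((\<lambda>v. v x) ` ?S)" if "x \<in> pverts G" for x
    using assms(8)[OF that] by (auto simp: bdd_above_def)
  have le: "v x \<le> u x" if "v \<in> ?S" "x \<in> pverts G" for v x
    using cSUP_upper[OF that(1) bdd[OF that(2)]] that(2) assms(9) by simp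
  have least: "u x \<le> t" if "x \<in> pverts G" "\<And>v. v \<in> ?S \<Longrightarrow> v x \<le> t" for x t
    using cSUP_least[OF assms(7), of "\<lambda>v. v x" t] that assms(9) by simp
  have ext: "u \<in> pverts G \<rightarrow>\<^sub>E UNIV" using assms(9) by simp
  have u: "u \<in> ?S" by (rule Sup_subsolution) (use le least ext in auto)
  have "w = u" if w: "w \<in> pverts G \<rightarrow>\<^sub>E UNIV" "solves G \<O> n f g w" for w
  proof (rule PiE_ext[OF w(1) ext])
    fix x assume x: "x \<in> pverts G"
    \<comment> \<open>A solution is a subsolution, hence below \<open>u\<close>; comparison of the
      subsolution \<open>u\<close> with \<open>w\<close> gives the reverse inequality.\<close>
    have "w \<in> ?S" using w by (simp add: subsolutions_iff solves_iff)
    then show "w x = u x" using le[OF _ x] comparison[OF u w(2) x] by (intro antisym)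
  qed
  moreover have "solves G \<O> n f g u" by (rule greatest_subsolution_solves[OF u]) (rule le)
  ultimately show ?thesis by blast
qed

end
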